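(* Let $X$ be a complex Banach space and let $P_1,\ldots,P_n:X\to\mathbb C$ be continuous polynomials of norm one, of degrees $k_1,\ldots,k_n\ge 1$. Given real numbers $a_1,\ldots,a_n\geq 0$ satisfying $\sum_{i=1}^n a_i<\frac{1}{n^{n-1}}$, there is $z_0\in B_X$ such that $$|P_i(z_0)|\geq a_i^{k_i}\quad\text{for } i=1,\ldots,n.$$ Moreover, if $X$ is finite dimensional, the same conclusion also holds when $\sum_{i=1}^n a_i=\frac{1}{n^{n-1}}$.
   Context: $B_X$ denotes the (closed) unit ball of $X$. A function $P:X\to\mathbb C$ is a continuous $k$-homogeneous polynomial if there is a continuous $k$-linear function $T:X\times\cdots\times X\to\mathbb C$ with $P(z)=T(z,\ldots,z)$. A function $Q:X\to\mathbb C$ is a continuous polynomial of degree $k$ if $Q=\sum_{l=0}^k Q_l$ with $Q_0$ constant, $Q_l$ a continuous $l$-homogeneous polynomial for $1\le l\le k$, and $Q_k\ne 0$. The norm of a polynomial is $\|Q\|=\sup_{z\in B_X}|Q(z)|$. *)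

theory Defs
  imports "HOL-Analysis.Analysis"
begin

text \<open>
  Complex Banach spaces: a complete real normed space together with a complex scalar
  multiplication that extends the real one and is compatible with the norm.
\<close>

class complex_banach = banach +
  fixes scaleC :: "complex \<Rightarrow> 'a \<Rightarrow> 'a"
  assumes scaleC_add_right: "scaleC c (x + y) = scaleC c x + scaleC c y"
    and scaleC_add_left: "scaleC (c + d) x = scaleC c x + scaleC d x"
    and scaleC_scaleC: "scaleC c (scaleC d x) = scaleC (c * d) x"
    and scaleC_one: "scaleC 1 x = x"
    and scaleR_scaleC: "scaleR r x = scaleC (complex_of_real r) x"
    and norm_scaleC: "norm (scaleC c x) = cmod c * norm x"

lemma vector_space_scaleC:
  "vector_space (scaleC :: complex \<Rightarrow> 'a \<Rightarrow> 'a::complex_banach)"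
  by unfold_locales
    (simp_all add: scaleC_add_right scaleC_add_left scaleC_scaleC scaleC_one)

instantiation complex :: complex_banach
begin

definition scaleC_complex :: "complex \<Rightarrow> complex \<Rightarrow> complex"
  where "scaleC_complex c x = c * x"

instance
  by standard
    (simp_all add: scaleC_complex_def algebra_simps norm_mult scaleR_conv_of_real)

end

text \<open>
  Dimension is taken over the complex scalars; the type \<open>'a\<close> is passed as a term of type
  \<^typ>\<open>'a itself\<close>.
\<close>

definition finite_dimensional :: "'a::complex_banach itself \<Rightarrow> bool"
  where "finite_dimensional _ \<longleftrightarrow>
    (\<exists>B. finite_dimensional_vector_space (scaleC :: complex \<Rightarrow> 'a \<Rightarrow> 'a) B)"

text \<open>
  A \<open>k\<close>-tuple of vectors is an extensional function on \<open>{..<k}\<close>, so that the product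
  topology below is that of the \<open>k\<close>-fold product of the space with itself.
\<close>

definition continuous_multilinear :: "nat \<Rightarrow> ((nat \<Rightarrow> 'a::complex_banach) \<Rightarrow> complex) \<Rightarrow> bool"
  where "continuous_multilinear k T \<longleftrightarrow>
    (\<forall>x \<in> {..<k} \<rightarrow>\<^sub>E UNIV. \<forall>i<k. Vector_Spaces.linear scaleC (*) (\<lambda>u. T (x(i := u)))) \<and>
    continuous_map (product_topology (\<lambda>_. euclidean) {..<k}) euclidean T"

definition homogeneous_polynomial :: "nat \<Rightarrow> ('a::complex_banach \<Rightarrow> complex) \<Rightarrow> bool"
  where "homogeneous_polynomial k P \<longleftrightarrow>
    (\<exists>T. continuous_multilinear k T \<and> (\<forall>z. P z = T (\<lambda>_\<in>{..<k}. z)))"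

definition polynomial_of_degree :: "nat \<Rightarrow> ('a::complex_banach \<Rightarrow> complex) \<Rightarrow> bool"
  where "polynomial_of_degree k Q \<longleftrightarrow>
    (\<exists>q. (\<exists>c. q 0 = (\<lambda>_. c)) \<and> (\<forall>l\<in>{1..k}. homogeneous_polynomial l (q l)) \<and>
         q k \<noteq> (\<lambda>_. 0) \<and> (\<forall>z. Q z = (\<Sum>l=0..k. q l z)))"

text \<open>
  The supremum is taken in the reals; it is meaningful for continuous polynomials, which are
  bounded on the unit ball.
\<close>

definition polynomial_norm :: "('a::complex_banach \<Rightarrow> complex) \<Rightarrow> real"
  where "polynomial_norm Q = (SUP z\<in>cball 0 1. cmod (Q z))"

end

theory Submission
  imports Defs "HOL-Complex_Analysis.Conformal_Mappings"
begin

text \<open>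
  The theorem follows from a lower bound for products. Suppose that \<open>\<bar>P\<^sub>i(z\<^sub>i)\<bar>\<close> is close to \<open>1\<close>
  with \<open>z\<^sub>i\<close> in the unit ball, let \<open>t\<^sub>1 + \<dots> + t\<^sub>n = 1\<close>, and look at the points
  \<open>x = w\<^sub>1 t\<^sub>1 z\<^sub>1 + \<dots> + w\<^sub>n t\<^sub>n z\<^sub>n\<close> with \<open>\<bar>w\<^sub>i\<bar> = 1\<close>, which lie in the unit ball. If the \<open>P\<^sub>i\<close> are
  homogeneous, then \<open>P\<^sub>i(x)\<close> is a polynomial in \<open>w\<^sub>i\<close> whose coefficient at \<open>w\<^sub>i\<close> to the power \<open>k\<^sub>i\<close> is
  \<open>P\<^sub>i(t\<^sub>i z\<^sub>i)\<close>. Reversing the coefficients of a polynomial does not change its modulus on the unit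
  circle and moves the top coefficient to the origin, so the maximum principle
  (\<open>leading_coefficient_le_sup\<close>) gives a unimodular \<open>w\<^sub>i\<close> at which the product of all powers is
  at least the one where \<open>P\<^sub>i(x)\<close> is replaced by \<open>P\<^sub>i(t\<^sub>i z\<^sub>i)\<close> and \<open>w\<^sub>i\<close> is set to \<open>0\<close> in the
  other factors. Setting \<open>w\<^sub>i\<close> to \<open>0\<close> does not affect the top coefficients of those factors in
  their own variables, so the step can be repeated, one variable after the other, and some \<open>z\<close> in
  the ball satisfies
  \<open>\<Prod>\<^sub>i \<bar>P\<^sub>i(z)\<bar> ^ N\<^sub>i \<ge> \<Prod>\<^sub>i (t\<^sub>i ^ k\<^sub>i * \<bar>P\<^sub>i(z\<^sub>i)\<bar>) ^ N\<^sub>i\<close> for arbitrary exponents \<open>N\<^sub>i\<close>.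
  Polynomials that are not homogeneous are first homogenized by one additional complex variable,
  which a last application of the maximum principle puts back on the unit circle
  (\<open>polynomial_product_lower_bound\<close>).

  Since \<open>\<bar>P\<^sub>j(z)\<bar> \<le> 1\<close> for all \<open>j\<close>, each single factor \<open>\<bar>P\<^sub>i(z)\<bar> ^ N\<^sub>i\<close> is bounded below by the same
  quantity. It remains to choose \<open>t\<close> and \<open>N\<close> such that this quantity exceeds
  \<open>a\<^sub>i ^ (k\<^sub>i N\<^sub>i)\<close> for every \<open>i\<close>. Taking \<open>k\<^sub>i N\<^sub>i\<close> nearly proportional to \<open>t\<^sub>i\<close>
  (\<open>exists_exponents\<close>), one needs \<open>t\<^sub>i ln a\<^sub>i < \<Sum>\<^sub>j t\<^sub>j ln t\<^sub>j\<close>. The choice of \<open>t\<^sub>i\<close> inversely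
  proportional to \<open>- ln a\<^sub>i\<close> makes the left sides equal, and then the inequality is a consequence of
  \<open>\<Sum>\<^sub>i a\<^sub>i < 1 / n ^ (n - 1)\<close> by two applications of the Gibbs inequality (\<open>exists_weights\<close>).

  In finite dimension the unit ball is compact, and the case of equality is a limit of cases
  with strict inequality.
\<close>

section \<open>One-variable estimates\<close>

lemma exists_unit_modulus_max:
  fixes g :: "complex \<Rightarrow> complex"
  assumes hol: "g holomorphic_on UNIV" and s: "cmod s \<le> 1"
  shows "\<exists>u. cmod u = 1 \<and> cmod (g s) \<le> cmod (g u)"
proof -
  have cont: "continuous_on A g" for A
    using hol holomorphic_on_imp_continuous_on holomorphic_on_subset by blast
  have "continuous_on (sphere 0 1) (\<lambda>u. cmod (g u))"
    by (intro continuous_on_norm cont)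
  then obtain u where u: "u \<in> sphere 0 1" "\<forall>y\<in>sphere 0 1. cmod (g y) \<le> cmod (g u)"
    using continuous_attains_sup[of "sphere 0 1 :: complex set"]
    by (metis compact_sphere norm_one mem_sphere_0 empty_iff)
  have "cmod (g s) \<le> cmod (g u)"
  proof (rule maximum_modulus_frontier[where f = g and S = "cball 0 1"])
    show "g holomorphic_on interior (cball 0 1)"
      using hol holomorphic_on_subset by blast
  qed (use u s cont in \<open>auto simp: frontier_cball\<close>)
  with u(1) show ?thesis by auto
qed

text \<open>
  On the unit circle \<open>p(u) = \<Sum>\<^sub>l b\<^sub>l u\<^sup>l\<close> has the same modulus as its reciprocal polynomial
  \<open>u ^ d * cnj (p(1 / cnj u))\<close>, whose value at \<open>0\<close> is the conjugate of \<open>b d\<close>; the maximum principle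
  is applied to \<open>h\<close> times the power \<open>N\<close> of the reciprocal polynomial.
\<close>

lemma leading_coefficient_le_sup:
  fixes h :: "complex \<Rightarrow> complex" and b :: "nat \<Rightarrow> complex"
  assumes hol: "h holomorphic_on UNIV"
  shows "\<exists>u. cmod u = 1 \<and>
    cmod (b d) ^ N * cmod (h 0) \<le> cmod (\<Sum>l\<le>d. b l * u ^ l) ^ N * cmod (h u)"
proof -
  define r where "r = (\<lambda>u. \<Sum>l\<le>d. cnj (b l) * u ^ (d - l))"
  have r_circle: "cmod (r u) = cmod (\<Sum>l\<le>d. b l * u ^ l)" if "cmod u = 1" for u
  proof -
    have uu: "u * cnj u = 1"
      using that complex_norm_square[of u] by simp
    have "u ^ (d - l) = u ^ d * cnj u ^ l" if "l \<le> d" for l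
    proof -
      have "u ^ d * cnj u ^ l = u ^ (d - l) * (u * cnj u) ^ l"
        using that by (simp add: power_mult_distrib power_add[symmetric] mult.assoc[symmetric])
      with uu show ?thesis by simp
    qed
    then have "r u = u ^ d * cnj (\<Sum>l\<le>d. b l * u ^ l)"
      unfolding r_def by (simp add: sum_distrib_left algebra_simps)
    then show ?thesis
      using that by (simp add: norm_mult norm_power del: cnj_sum)
  qed
  have r0: "r 0 = cnj (b d)"
  proof -
    have "r 0 = (\<Sum>l\<le>d. if l = d then cnj (b d) else 0)"
      unfolding r_def by (intro sum.cong) (auto simp: power_0_left)
    then show ?thesis by simp
  qed
  have "(\<lambda>u. r u ^ N * h u) holomorphic_on UNIV"
    unfolding r_def by (intro holomorphic_intros hol)
  from exists_unit_modulus_max[OF this, of 0] obtain u where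
    "cmod u = 1" "cmod (r 0 ^ N * h 0) \<le> cmod (r u ^ N * h u)" by auto
  with r0 r_circle show ?thesis
    by (intro exI[of _ u]) (simp add: norm_mult norm_power)
qed

section \<open>Homogeneous forms on complex planes\<close>

text \<open>
  Of a homogeneous polynomial on a complex Banach space only the restrictions to the complex planes
  spanned by two vectors matter below: they contain both the homogeneity and the expansion
  along affine lines.
\<close>

definition binary_form :: "nat \<Rightarrow> (complex \<Rightarrow> complex \<Rightarrow> complex) \<Rightarrow> bool"
  where "binary_form k F \<longleftrightarrow>
    (\<exists>b. \<forall>\<alpha> \<beta>. F \<alpha> \<beta> = (\<Sum>l\<le>k. b l * \<alpha> ^ (k - l) * \<beta> ^ l))"

definition planar_form :: "nat \<Rightarrow> ('b::complex_banach \<Rightarrow> complex) \<Rightarrow> bool"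
  where "planar_form k H \<longleftrightarrow>
    (\<forall>x y. binary_form k (\<lambda>\<alpha> \<beta>. H (scaleC \<alpha> x + scaleC \<beta> y)))"

lemma binary_form_const: "binary_form 0 (\<lambda>_ _. c)"
  unfolding binary_form_def by (rule exI[of _ "\<lambda>_. c"]) simp

lemma binary_form_add:
  assumes "binary_form k F" "binary_form k G"
  shows "binary_form k (\<lambda>\<alpha> \<beta>. F \<alpha> \<beta> + G \<alpha> \<beta>)"
proof -
  obtain b c where "\<And>\<alpha> \<beta>. F \<alpha> \<beta> = (\<Sum>l\<le>k. b l * \<alpha> ^ (k - l) * \<beta> ^ l)"
    "\<And>\<alpha> \<beta>. G \<alpha> \<beta> = (\<Sum>l\<le>k. c l * \<alpha> ^ (k - l) * \<beta> ^ l)"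
    using assms unfolding binary_form_def by auto
  then show ?thesis
    unfolding binary_form_def
    by (intro exI[of _ "\<lambda>l. b l + c l"]) (simp add: sum.distrib algebra_simps)
qed

lemma binary_form_sum:
  assumes "finite A" "\<And>i. i \<in> A \<Longrightarrow> binary_form k (F i)"
  shows "binary_form k (\<lambda>\<alpha> \<beta>. \<Sum>i\<in>A. F i \<alpha> \<beta>)"
  using assms
proof (induction A rule: finite_induct)
  case empty
  show ?case unfolding binary_form_def by (rule exI[of _ "\<lambda>_. 0"]) simp
next
  case (insert i A)
  then show ?case by (simp add: binary_form_add)
qed

text \<open>
  The induction step for products of linear forms and, more generally, for multilinear maps: an
  additional argument \<open>\<alpha> x + \<beta> y\<close> contributes \<open>\<alpha>\<close> times one form plus \<open>\<beta>\<close> times another.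
\<close>

lemma binary_form_combine:
  assumes "binary_form k F" "binary_form k G"
  shows "binary_form (Suc k) (\<lambda>\<alpha> \<beta>. \<alpha> * F \<alpha> \<beta> + \<beta> * G \<alpha> \<beta>)"
proof -
  obtain b c where F: "\<And>\<alpha> \<beta>. F \<alpha> \<beta> = (\<Sum>l\<le>k. b l * \<alpha> ^ (k - l) * \<beta> ^ l)"
    and G: "\<And>\<alpha> \<beta>. G \<alpha> \<beta> = (\<Sum>l\<le>k. c l * \<alpha> ^ (k - l) * \<beta> ^ l)"
    using assms unfolding binary_form_def by auto
  have "binary_form (Suc k) (\<lambda>\<alpha> \<beta>. \<alpha> * F \<alpha> \<beta>)"
    unfolding binary_form_def F
  proof (rule exI[of _ "\<lambda>l. if l \<le> k then b l else 0"], intro allI)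
    fix \<alpha> \<beta> :: complex
    show "\<alpha> * (\<Sum>l\<le>k. b l * \<alpha> ^ (k - l) * \<beta> ^ l) =
      (\<Sum>l\<le>Suc k. (if l \<le> k then b l else 0) * \<alpha> ^ (Suc k - l) * \<beta> ^ l)"
      by (auto simp: sum_distrib_left Suc_diff_le algebra_simps intro!: sum.cong)
  qed
  moreover have "binary_form (Suc k) (\<lambda>\<alpha> \<beta>. \<beta> * G \<alpha> \<beta>)"
    unfolding binary_form_def G
  proof (rule exI[of _ "\<lambda>l. case l of 0 \<Rightarrow> 0 | Suc m \<Rightarrow> c m"], intro allI)
    fix \<alpha> \<beta> :: complex
    show "\<beta> * (\<Sum>l\<le>k. c l * \<alpha> ^ (k - l) * \<beta> ^ l) =
      (\<Sum>l\<le>Suc k. (case l of 0 \<Rightarrow> 0 | Suc m \<Rightarrow> c m) * \<alpha> ^ (Suc k - l) * \<beta> ^ l)"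
      by (subst sum.atMost_Suc_shift) (simp add: sum_distrib_left algebra_simps)
  qed
  ultimately show ?thesis by (rule binary_form_add)
qed

lemma planar_form_times_linear_power:
  assumes "planar_form k H"
    and "\<And>\<alpha> \<beta> x y. L (scaleC \<alpha> x + scaleC \<beta> y) = \<alpha> * L x + \<beta> * L y"
  shows "planar_form (k + j) (\<lambda>v. L v ^ j * H v)"
proof (induction j)
  case 0
  then show ?case using assms(1) by simp
next
  case (Suc j)
  show ?case
    unfolding planar_form_def
  proof (intro allI)
    fix x y
    let ?F = "\<lambda>\<alpha> \<beta>. L (scaleC \<alpha> x + scaleC \<beta> y) ^ j * H (scaleC \<alpha> x + scaleC \<beta> y)"
    have F: "binary_form (k + j) (\<lambda>\<alpha> \<beta>. c * ?F \<alpha> \<beta>)" for c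
    proof -
      obtain b where "\<And>\<alpha> \<beta>. ?F \<alpha> \<beta> = (\<Sum>l\<le>k+j. b l * \<alpha> ^ (k + j - l) * \<beta> ^ l)"
        using Suc unfolding planar_form_def binary_form_def by metis
      then show ?thesis
        unfolding binary_form_def
        by (intro exI[of _ "\<lambda>l. c * b l"]) (simp add: sum_distrib_left mult.assoc)
    qed
    from binary_form_combine[OF F[of "L x"] F[of "L y"]]
    show "binary_form (k + Suc j) (\<lambda>\<alpha> \<beta>. L (scaleC \<alpha> x + scaleC \<beta> y) ^ Suc j *
        H (scaleC \<alpha> x + scaleC \<beta> y))"
      by (simp add: assms(2) algebra_simps)
  qed
qed

lemma scaleC_zero_left: "scaleC 0 (x :: 'b::complex_banach) = 0"
  using norm_scaleC[of 0 x] by simp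

text \<open>
  The expansion along an affine line is the case \<open>\<alpha> = 1\<close> of the binary form; its top coefficient is
  the value of the form at \<open>\<alpha> = 0\<close>, \<open>\<beta> = 1\<close>, that is, at the direction of the line.
\<close>

lemma planar_form_affine:
  assumes "planar_form k H"
  obtains b where "\<And>u. H (x + scaleC u y) = (\<Sum>l\<le>k. b l * u ^ l)" and "b k = H y"
proof -
  obtain b where b: "\<And>\<alpha> \<beta>. H (scaleC \<alpha> x + scaleC \<beta> y) =
      (\<Sum>l\<le>k. b l * \<alpha> ^ (k - l) * \<beta> ^ l)"
    using assms unfolding planar_form_def binary_form_def by blast
  have "H y = (\<Sum>l\<le>k. if l = k then b k else 0)"
    using b[of 0 1]
    by (simp add: scaleC_zero_left scaleC_one power_0_left if_distrib[of "(*) _"] cong: if_cong)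
  moreover have "H (x + scaleC u y) = (\<Sum>l\<le>k. b l * u ^ l)" for u
    using b[of 1 u] by (simp add: scaleC_one)
  ultimately show ?thesis using that[of b] by simp
qed

lemma planar_form_scale:
  assumes "planar_form k H"
  shows "H (scaleC c x) = c ^ k * H x"
proof -
  obtain b where b: "\<And>\<alpha> \<beta>. H (scaleC \<alpha> x + scaleC \<beta> x) =
      (\<Sum>l\<le>k. b l * \<alpha> ^ (k - l) * \<beta> ^ l)"
    using assms unfolding planar_form_def binary_form_def by blast
  have "H (scaleC \<alpha> x) = (\<Sum>l\<le>k. if l = 0 then b 0 * \<alpha> ^ k else 0)" for \<alpha>
    using b[of \<alpha> 0] by (simp add: scaleC_zero_left power_0_left if_distrib[of "(*) _"] cong: if_cong)
  from this[of c] this[of 1] show ?thesis by (simp add: scaleC_one)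
qed

text \<open>
  The vector \<open>\<alpha> x + \<beta> y\<close> is put into the first \<open>m\<close> slots only, and the other slots are arbitrary;
  splitting the slot \<open>m\<close> by linearity then leaves two instances of the induction hypothesis.
\<close>

lemma continuous_multilinear_planar:
  fixes T :: "(nat \<Rightarrow> 'a::complex_banach) \<Rightarrow> complex"
  assumes T: "continuous_multilinear k T" and "m \<le> k" and "g \<in> {..<k} \<rightarrow>\<^sub>E UNIV"
  shows "binary_form m (\<lambda>\<alpha> \<beta>. T (\<lambda>i. if i < m then scaleC \<alpha> x + scaleC \<beta> y else g i))"
  using assms(2,3)
proof (induction m arbitrary: g)
  case 0
  then show ?case by (simp add: binary_form_const)
next
  case (Suc m)
  let ?h = "\<lambda>g z i. if i < m then z else (g :: nat \<Rightarrow> 'a) i"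
  have step: "T (\<lambda>i. if i < Suc m then scaleC \<alpha> x + scaleC \<beta> y else g i) =
      \<alpha> * T (?h (g(m := x)) (scaleC \<alpha> x + scaleC \<beta> y)) +
      \<beta> * T (?h (g(m := y)) (scaleC \<alpha> x + scaleC \<beta> y))" for \<alpha> \<beta>
  proof -
    let ?z = "scaleC \<alpha> x + scaleC \<beta> y"
    have "?h g ?z \<in> {..<k} \<rightarrow>\<^sub>E UNIV"
      using Suc.prems by (auto simp: PiE_iff extensional_def)
    then have "Vector_Spaces.linear scaleC (*) (\<lambda>u. T ((?h g ?z)(m := u)))"
      using T Suc.prems unfolding continuous_multilinear_def by auto
    then interpret lin: Vector_Spaces.linear scaleC "(*)" "\<lambda>u. T ((?h g ?z)(m := u))" .
    have upd: "(?h g ?z)(m := u) = ?h (g(m := u)) ?z" for u by auto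
    have "(\<lambda>i. if i < Suc m then ?z else g i) = (?h g ?z)(m := ?z)" by auto
    then show ?thesis
      using lin.add[of "scaleC \<alpha> x" "scaleC \<beta> y"] lin.scale[of \<alpha> x] lin.scale[of \<beta> y]
      by (simp only: upd)
  qed
  have "g(m := u) \<in> {..<k} \<rightarrow>\<^sub>E UNIV" for u
    using Suc.prems by (auto simp: PiE_iff extensional_def)
  then show ?case
    unfolding step using Suc.prems(1) by (intro binary_form_combine Suc.IH) (auto simp del: fun_upd_apply)
qed

lemma homogeneous_polynomial_planar:
  assumes "homogeneous_polynomial k P"
  shows "planar_form k P"
proof -
  obtain T where T: "continuous_multilinear k T" and P: "\<And>z. P z = T (\<lambda>_\<in>{..<k}. z)"
    using assms unfolding homogeneous_polynomial_def by auto
  show ?thesis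
    unfolding planar_form_def P
    using continuous_multilinear_planar[OF T order_refl, of "\<lambda>_. undefined"]
    by (simp add: restrict_def PiE_iff extensional_def)
qed

text \<open>
  The homogenizations below live on the product of the space with \<open>complex\<close>.
\<close>

instantiation prod :: (complex_banach, complex_banach) complex_banach
begin

definition scaleC_prod :: "complex \<Rightarrow> 'a \<times> 'b \<Rightarrow> 'a \<times> 'b"
  where "scaleC_prod c v = (scaleC c (fst v), scaleC c (snd v))"

instance
proof
  fix c :: complex and v :: "'a \<times> 'b"
  have "norm (scaleC c v) = sqrt ((cmod c)\<^sup>2 * ((norm (fst v))\<^sup>2 + (norm (snd v))\<^sup>2))"
    by (simp add: norm_prod_def scaleC_prod_def norm_scaleC algebra_simps)
  then show "norm (scaleC c v) = cmod c * norm v"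
    by (simp add: norm_prod_def real_sqrt_mult)
qed (auto simp: scaleC_prod_def scaleC_add_right scaleC_add_left scaleC_scaleC scaleC_one
    scaleR_scaleC prod_eq_iff)

end

text \<open>
  The homogenization is \<open>H (x, s) = \<Sum>\<^sub>l s ^ (k - l) * q\<^sub>l x\<close>, where \<open>q\<^sub>l\<close> is the part of degree \<open>l\<close>.
\<close>

lemma polynomial_homogenization:
  fixes Q :: "'a::complex_banach \<Rightarrow> complex"
  assumes "polynomial_of_degree k Q"
  obtains H :: "'a \<times> complex \<Rightarrow> complex" where "planar_form k H" and "\<And>x. H (x, 1) = Q x"
proof -
  obtain q c where q0: "q 0 = (\<lambda>_. c)"
    and hom: "\<And>l. l \<in> {1..k} \<Longrightarrow> homogeneous_polynomial l (q l)"
    and Q: "\<And>z. Q z = (\<Sum>l=0..k. q l z)"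
    using assms unfolding polynomial_of_degree_def by metis
  define H where "H = (\<lambda>v :: 'a \<times> complex. \<Sum>l=0..k. snd v ^ (k - l) * q l (fst v))"
  have "planar_form k (\<lambda>v :: 'a \<times> complex. snd v ^ (k - l) * q l (fst v))" if "l \<in> {0..k}" for l
  proof -
    have "planar_form l (q l)"
    proof (cases "l = 0")
      case True
      then show ?thesis by (simp add: q0 planar_form_def binary_form_const)
    next
      case False
      then show ?thesis using that by (intro homogeneous_polynomial_planar hom) auto
    qed
    then have "planar_form l (\<lambda>v :: 'a \<times> complex. q l (fst v))"
      by (simp add: planar_form_def scaleC_prod_def)
    from planar_form_times_linear_power[OF this, where L = snd and j = "k - l"] that
    show ?thesis by (simp add: scaleC_prod_def scaleC_complex_def)
  qed
  then have "planar_form k H"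
    unfolding H_def planar_form_def by (auto intro!: binary_form_sum)
  moreover have "H (x, 1) = Q x" for x by (simp add: H_def Q)
  ultimately show ?thesis using that by blast
qed

section \<open>A lower bound for products of polynomials\<close>

lemma planar_form_holomorphic:
  assumes "planar_form k H"
  shows "(\<lambda>u. H (x + scaleC u y)) holomorphic_on A"
proof -
  obtain b where "\<And>u. H (x + scaleC u y) = (\<Sum>l\<le>k. b l * u ^ l)"
    using planar_form_affine[OF assms] by metis
  then show ?thesis by (simp add: holomorphic_intros)
qed

text \<open>
  Induction over the factors. The point \<open>x\<close> given by the induction hypothesis is moved along the
  direction \<open>y m\<close> of the new factor. For \<open>u = 0\<close> the old factors have their old values, and
  \<open>H m (x + u y\<^sub>m)\<close> has top coefficient \<open>H m (y m)\<close> for every \<open>x\<close>, so that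
  \<open>leading_coefficient_le_sup\<close> yields the product of the two bounds.
\<close>

lemma planar_forms_product_lower_bound:
  fixes y :: "'i \<Rightarrow> 'b::complex_banach"
  assumes "finite I" and "\<And>i. i \<in> I \<Longrightarrow> planar_form (k i) (H i)"
  shows "\<exists>w. (\<forall>i\<in>I. cmod (w i) = 1) \<and>
    (\<Prod>i\<in>I. cmod (H i (y i)) ^ N i) \<le> (\<Prod>i\<in>I. cmod (H i (\<Sum>j\<in>I. scaleC (w j) (y j))) ^ N i)"
  using assms
proof (induction I rule: finite_induct)
  case empty
  then show ?case by simp
next
  case (insert m I)
  then obtain w where w: "\<forall>i\<in>I. cmod (w i) = 1"
    and bound: "(\<Prod>i\<in>I. cmod (H i (y i)) ^ N i) \<le>
      (\<Prod>i\<in>I. cmod (H i (\<Sum>j\<in>I. scaleC (w j) (y j))) ^ N i)"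
    by auto
  define x where "x = (\<Sum>j\<in>I. scaleC (w j) (y j))"
  define h where "h = (\<lambda>u. \<Prod>i\<in>I. H i (x + scaleC u (y m)) ^ N i)"
  obtain b where b: "\<And>u. H m (x + scaleC u (y m)) = (\<Sum>l\<le>k m. b l * u ^ l)"
    and b_top: "b (k m) = H m (y m)"
    using planar_form_affine[of "k m" "H m" x "y m"] insert.prems by auto
  have "h holomorphic_on UNIV"
    unfolding h_def using insert.prems
    by (intro holomorphic_intros planar_form_holomorphic) auto
  from leading_coefficient_le_sup[OF this, of b "k m" "N m"] obtain u where u: "cmod u = 1"
    and ub: "cmod (H m (y m)) ^ N m * cmod (h 0) \<le> cmod (H m (x + scaleC u (y m))) ^ N m * cmod (h u)"
    by (auto simp: b b_top)
  have "(\<Prod>i\<in>I. cmod (H i (y i)) ^ N i) \<le> cmod (h 0)"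
    using bound unfolding h_def x_def[symmetric]
    by (simp add: scaleC_zero_left norm_power prod_norm[symmetric])
  then have "cmod (H m (y m)) ^ N m * (\<Prod>i\<in>I. cmod (H i (y i)) ^ N i) \<le>
      cmod (H m (x + scaleC u (y m))) ^ N m * cmod (h u)"
    by (rule order_trans[OF mult_left_mono ub]) simp
  moreover have "(\<Sum>j\<in>insert m I. scaleC ((w(m := u)) j) (y j)) = x + scaleC u (y m)"
  proof -
    have "(\<Sum>j\<in>I. scaleC ((w(m := u)) j) (y j)) = x"
      unfolding x_def using insert.hyps by (intro sum.cong) auto
    then show ?thesis using insert.hyps by (simp add: add.commute)
  qed
  ultimately show ?case
    using insert.hyps w u
    by (intro exI[of _ "w(m := u)"]) (auto simp: h_def norm_power prod_norm[symmetric] add.commute)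
qed

text \<open>
  The lower bound for forms is applied to the homogenizations at \<open>t\<^sub>i (z\<^sub>i, 1)\<close>. The resulting point
  \<open>(x, s)\<close> has \<open>\<bar>s\<bar> \<le> 1\<close>, and \<open>x / s\<close> may leave the unit ball; the maximum principle in \<open>s\<close> for
  fixed \<open>x\<close> replaces \<open>s\<close> by a unimodular number \<open>v\<close>, and \<open>x / v\<close> is as required.
\<close>

proposition polynomial_product_lower_bound:
  fixes P :: "'i \<Rightarrow> 'a::complex_banach \<Rightarrow> complex"
  assumes I: "finite I"
    and P: "\<And>i. i \<in> I \<Longrightarrow> polynomial_of_degree (k i) (P i)"
    and z: "\<And>i. i \<in> I \<Longrightarrow> norm (z i) \<le> 1"
    and t: "\<And>i. i \<in> I \<Longrightarrow> 0 \<le> t i" "(\<Sum>i\<in>I. t i) \<le> 1"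
  shows "\<exists>z0\<in>cball 0 1. (\<Prod>i\<in>I. (t i ^ k i * cmod (P i (z i))) ^ N i) \<le>
    (\<Prod>i\<in>I. cmod (P i z0) ^ N i)"
proof -
  have "\<forall>i\<in>I. \<exists>H :: 'a \<times> complex \<Rightarrow> complex. planar_form (k i) H \<and> (\<forall>x. H (x, 1) = P i x)"
    using polynomial_homogenization P by metis
  then obtain H :: "'i \<Rightarrow> 'a \<times> complex \<Rightarrow> complex"
    where H: "\<And>i. i \<in> I \<Longrightarrow> planar_form (k i) (H i)"
      and H1: "\<And>i x. i \<in> I \<Longrightarrow> H i (x, 1) = P i x"
    by metis
  define y where "y = (\<lambda>i. scaleC (complex_of_real (t i)) (z i, 1 :: complex))"
  obtain w where w: "\<And>i. i \<in> I \<Longrightarrow> cmod (w i) = 1"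
    and bound: "(\<Prod>i\<in>I. cmod (H i (y i)) ^ N i) \<le>
      (\<Prod>i\<in>I. cmod (H i (\<Sum>j\<in>I. scaleC (w j) (y j))) ^ N i)"
    using planar_forms_product_lower_bound[of I k H y N, OF I H] by auto
  have y_val: "cmod (H i (y i)) = t i ^ k i * cmod (P i (z i))" if "i \<in> I" for i
    using that t(1) unfolding y_def
    by (simp add: planar_form_scale[OF H] H1 norm_mult norm_power)
  define x s where "x = fst (\<Sum>j\<in>I. scaleC (w j) (y j))" and "s = snd (\<Sum>j\<in>I. scaleC (w j) (y j))"
  have "norm x \<le> (\<Sum>j\<in>I. t j)"
  proof -
    have "norm x \<le> (\<Sum>j\<in>I. norm (scaleC (w j) (scaleC (complex_of_real (t j)) (z j))))"
      unfolding x_def by (simp add: fst_sum y_def scaleC_prod_def norm_sum)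
    also have "\<dots> \<le> (\<Sum>j\<in>I. t j)"
      using w z t(1) by (intro sum_mono) (simp add: norm_scaleC mult_left_le)
    finally show ?thesis .
  qed
  moreover have "cmod s \<le> (\<Sum>j\<in>I. t j)"
  proof -
    have "cmod s \<le> (\<Sum>j\<in>I. cmod (w j * complex_of_real (t j)))"
      unfolding s_def by (simp add: snd_sum y_def scaleC_prod_def scaleC_complex_def norm_sum)
    also have "\<dots> \<le> (\<Sum>j\<in>I. t j)"
      using w t(1) by (intro sum_mono) (simp add: norm_mult)
    finally show ?thesis .
  qed
  ultimately have x: "norm x \<le> 1" and s: "cmod s \<le> 1"
    using t(2) by auto
  define g where "g = (\<lambda>s. \<Prod>i\<in>I. H i (x, s) ^ N i)"
  have line: "(x, s) = (x, 0) + scaleC s (0, 1)" for s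
    using norm_scaleC[of s "0 :: 'a"] by (simp add: scaleC_prod_def scaleC_complex_def)
  have "g holomorphic_on UNIV"
    unfolding g_def
    by (subst line) (intro holomorphic_intros planar_form_holomorphic[OF H])
  from exists_unit_modulus_max[OF this s] obtain v where v: "cmod v = 1" "cmod (g s) \<le> cmod (g v)"
    by auto
  have v0: "v \<noteq> 0" using v(1) by auto
  let ?z0 = "scaleC (inverse v) x"
  have "cmod (H i (x, v)) = cmod (P i ?z0)" if "i \<in> I" for i
  proof -
    have "(x, v) = scaleC v (?z0, 1)"
      using v0 by (simp add: scaleC_prod_def scaleC_complex_def scaleC_scaleC scaleC_one)
    then show ?thesis
      using that v(1) by (simp add: planar_form_scale[OF H] H1 norm_mult norm_power)
  qed
  then have "cmod (g v) = (\<Prod>i\<in>I. cmod (P i ?z0) ^ N i)"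
    unfolding g_def by (simp add: norm_power prod_norm[symmetric])
  moreover have "(\<Prod>i\<in>I. (t i ^ k i * cmod (P i (z i))) ^ N i) \<le> cmod (g s)"
    using bound y_val by (simp add: g_def x_def s_def norm_power prod_norm[symmetric])
  moreover have "?z0 \<in> cball 0 1"
    using x v by (simp add: norm_scaleC norm_inverse)
  ultimately show ?thesis using v(2) by (intro bexI[of _ ?z0]) auto
qed

section \<open>The polynomials on the unit ball\<close>

lemma homogeneous_polynomial_continuous:
  fixes P :: "'a::complex_banach \<Rightarrow> complex"
  assumes "homogeneous_polynomial k P"
  shows "continuous_on UNIV P"
proof -
  obtain T where T: "continuous_map (product_topology (\<lambda>_. euclidean) {..<k}) euclidean T"
    and P: "\<And>z. P z = T (\<lambda>_\<in>{..<k}. z)"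
    using assms unfolding homogeneous_polynomial_def continuous_multilinear_def by auto
  have "continuous_map (euclidean :: 'a topology) (product_topology (\<lambda>_. euclidean) {..<k})
      (\<lambda>z. \<lambda>_\<in>{..<k}. z)"
    by (auto simp: continuous_map_componentwise)
  from continuous_map_compose[OF this T] show ?thesis
    by (simp add: P o_def)
qed

lemma polynomial_continuous:
  fixes Q :: "'a::complex_banach \<Rightarrow> complex"
  assumes "polynomial_of_degree k Q"
  shows "continuous_on A Q"
proof -
  obtain q c where q0: "q 0 = (\<lambda>_. c)"
    and hom: "\<And>l. l \<in> {1..k} \<Longrightarrow> homogeneous_polynomial l (q l)"
    and Q: "\<And>z. Q z = (\<Sum>l=0..k. q l z)"
    using assms unfolding polynomial_of_degree_def by metis
  have "continuous_on UNIV (q l)" if "l \<in> {0..k}" for l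
    using that q0 hom[of l] homogeneous_polynomial_continuous by (cases "l = 0") auto
  then have "continuous_on A (\<lambda>z. \<Sum>l=0..k. q l z)"
    by (intro continuous_on_sum) (blast intro: continuous_on_subset)
  then show ?thesis using Q by (simp cong: continuous_on_cong)
qed

text \<open>
  Continuity at \<open>0\<close> bounds the polynomial on a small ball, and homogeneity transports this bound to
  the unit ball. Boundedness is what makes the supremum in the polynomial norm meaningful.
\<close>

lemma homogeneous_polynomial_bounded:
  fixes P :: "'a::complex_banach \<Rightarrow> complex"
  assumes P: "homogeneous_polynomial k P"
  shows "\<exists>M. \<forall>z\<in>cball 0 1. cmod (P z) \<le> M"
proof -
  have "isCont P 0"
    using homogeneous_polynomial_continuous[OF P] by (simp add: continuous_on_eq_continuous_at)
  then obtain d where d: "d > 0" "\<And>z. norm z < d \<Longrightarrow> cmod (P z - P 0) < 1"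
    unfolding continuous_at_eps_delta by (metis diff_zero dist_norm zero_less_one)
  have "cmod (P z) \<le> (2 / d) ^ k * (1 + cmod (P 0))" if "z \<in> cball 0 1" for z
  proof -
    let ?c = "complex_of_real (d / 2)"
    have "norm (scaleC ?c z) < d"
      using that d(1) mult_left_mono[of "norm z" 1 "d/2"] by (simp add: norm_scaleC)
    then have "cmod (P (scaleC ?c z)) \<le> 1 + cmod (P 0)"
      using d(2)[of "scaleC ?c z"] norm_triangle_ineq2[of "P (scaleC ?c z)" "P 0"] by simp
    moreover have "P (scaleC (complex_of_real (2 / d)) (scaleC ?c z)) = P z"
      using d(1) by (simp add: scaleC_scaleC scaleC_one flip: of_real_mult)
    then have "cmod (P z) = (2 / d) ^ k * cmod (P (scaleC ?c z))"
      using d(1) planar_form_scale[OF homogeneous_polynomial_planar[OF P], of "complex_of_real (2 / d)" "scaleC ?c z"]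
      by (simp add: norm_mult norm_power norm_divide)
    ultimately show ?thesis
      using d(1) by (simp add: mult_left_mono)
  qed
  then show ?thesis by blast
qed

lemma polynomial_bdd_above:
  fixes Q :: "'a::complex_banach \<Rightarrow> complex"
  assumes "polynomial_of_degree k Q"
  shows "bdd_above ((\<lambda>z. cmod (Q z)) ` cball 0 1)"
proof -
  obtain q c where q0: "q 0 = (\<lambda>_. c)"
    and hom: "\<And>l. l \<in> {1..k} \<Longrightarrow> homogeneous_polynomial l (q l)"
    and Q: "\<And>z. Q z = (\<Sum>l=0..k. q l z)"
    using assms unfolding polynomial_of_degree_def by metis
  have "\<exists>M. \<forall>z\<in>cball 0 1. cmod (q l z) \<le> M" if "l \<in> {0..k}" for l
    using that q0 hom[of l] homogeneous_polynomial_bounded by (cases "l = 0") auto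
  then obtain M where M: "\<And>l z. l \<in> {0..k} \<Longrightarrow> z \<in> cball 0 1 \<Longrightarrow> cmod (q l z) \<le> M l"
    by metis
  have "cmod (Q z) \<le> (\<Sum>l=0..k. M l)" if "z \<in> cball 0 1" for z
    unfolding Q using M that by (intro order_trans[OF norm_sum] sum_mono)
  then show ?thesis by (auto intro!: bdd_aboveI[of _ "\<Sum>l=0..k. M l"])
qed

lemma polynomial_le_norm:
  assumes "polynomial_of_degree k Q" "z \<in> cball 0 1"
  shows "cmod (Q z) \<le> polynomial_norm Q"
  unfolding polynomial_norm_def
  using cSUP_upper[OF assms(2) polynomial_bdd_above[OF assms(1)]] by simp

lemma polynomial_almost_attains_norm:
  assumes "polynomial_of_degree k Q" "r < polynomial_norm Q"
  obtains z where "z \<in> cball 0 1" "r < cmod (Q z)"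
  using assms less_cSUP_iff[OF _ polynomial_bdd_above[OF assms(1)], of r]
  unfolding polynomial_norm_def by auto

section \<open>Choice of weights and exponents\<close>

text \<open>
  Summing \<open>ln x \<le> x - 1\<close> at \<open>x = b\<^sub>i / (s\<^sub>i \<Sum>\<^sub>j b\<^sub>j)\<close> with the weights \<open>s\<^sub>i\<close> gives the claim; it says
  that the relative entropy of \<open>s\<close> with respect to the normalization of \<open>b\<close> is nonnegative.
\<close>

lemma gibbs_inequality:
  fixes s b :: "'i \<Rightarrow> real"
  assumes "finite I" and s: "\<And>i. i \<in> I \<Longrightarrow> s i > 0" "(\<Sum>i\<in>I. s i) = 1"
    and b: "\<And>i. i \<in> I \<Longrightarrow> b i > 0"
  shows "(\<Sum>i\<in>I. s i * ln (b i)) - (\<Sum>i\<in>I. s i * ln (s i)) \<le> ln (\<Sum>i\<in>I. b i)"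
proof -
  define A where "A = (\<Sum>i\<in>I. b i)"
  have "I \<noteq> {}" using s(2) by auto
  then have A: "A > 0" unfolding A_def using assms by (intro sum_pos) auto
  have "s i * ln (b i) - s i * ln (s i) - s i * ln A \<le> b i / A - s i" if "i \<in> I" for i
  proof -
    have "s i * ln (b i / (s i * A)) \<le> s i * (b i / (s i * A) - 1)"
      using that s b A by (intro mult_left_mono ln_le_minus_one) (auto simp: less_imp_le)
    also have "\<dots> = b i / A - s i"
      using s(1)[OF that] by (simp add: algebra_simps)
    finally show ?thesis
      using s(1)[OF that] b[OF that] A by (simp add: ln_div ln_mult algebra_simps)
  qed
  then have "(\<Sum>i\<in>I. s i * ln (b i) - s i * ln (s i) - s i * ln A) \<le> (\<Sum>i\<in>I. b i / A - s i)"
    by (rule sum_mono)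
  also have "(\<Sum>i\<in>I. b i / A - s i) = 0"
    using A s(2) by (simp add: sum_subtractf sum_divide_distrib[symmetric] A_def[symmetric])
  finally show ?thesis
    using s(2) by (simp add: sum_subtractf sum_distrib_right[symmetric] A_def)
qed

text \<open>
  Let \<open>s\<^sub>i = c / (- ln a\<^sub>i)\<close> with \<open>c\<close> normalizing the sum, and let \<open>E = \<Sum>\<^sub>j s\<^sub>j ln s\<^sub>j\<close>; the claim is
  \<open>- c < E\<close>. The Gibbs inequality for \<open>a\<close> yields
  \<open>- n c - E \<le> ln (\<Sum>\<^sub>i a\<^sub>i) < - (n - 1) ln n\<close>, and for the constant function \<open>1\<close> it yields
  \<open>- E \<le> ln n\<close>. Together, \<open>n c > - E + (n - 1) ln n \<ge> - n E\<close>.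
\<close>

lemma exists_weights:
  fixes a :: "'i \<Rightarrow> real"
  assumes I: "finite I" "I \<noteq> {}" and a: "\<And>i. i \<in> I \<Longrightarrow> a i > 0"
    and sum_a: "(\<Sum>i\<in>I. a i) < 1 / real (card I) ^ (card I - 1)"
  shows "\<exists>s. (\<forall>i\<in>I. s i > 0) \<and> (\<Sum>i\<in>I. s i) = 1 \<and>
    (\<forall>i\<in>I. s i * ln (a i) < (\<Sum>j\<in>I. s j * ln (s j)))"
proof -
  define n where "n = card I"
  have n: "n \<ge> 1" using I by (simp add: n_def Suc_leI card_gt_0_iff)
  have "(\<Sum>i\<in>I. a i) < 1"
  proof -
    have "1 / real n ^ (n - 1) \<le> 1" using n by simp
    with sum_a show ?thesis unfolding n_def by linarith
  qed
  moreover have "a i \<le> (\<Sum>i\<in>I. a i)" if "i \<in> I" for i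
    using that I a by (intro member_le_sum) (auto simp: less_imp_le)
  ultimately have L: "- ln (a i) > 0" if "i \<in> I" for i
    using a[OF that] that by force
  define S where "S = (\<Sum>i\<in>I. 1 / - ln (a i))"
  have S: "S > 0" unfolding S_def using I L by (intro sum_pos) auto
  define s where "s = (\<lambda>i. 1 / S / - ln (a i))"
  have s_pos: "s i > 0" if "i \<in> I" for i
    unfolding s_def using S L[OF that] by (intro divide_pos_pos) auto
  have s_sum: "(\<Sum>i\<in>I. s i) = 1"
  proof -
    have "(\<Sum>i\<in>I. s i) = (1 / S) * (\<Sum>i\<in>I. 1 / - ln (a i))"
      unfolding s_def by (subst sum_distrib_left) simp
    then show ?thesis using S unfolding S_def[symmetric] by simp
  qed
  have s_ln: "s i * ln (a i) = - (1 / S)" if "i \<in> I" for i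
    using L[OF that] by (simp add: s_def)
  define E where "E = (\<Sum>j\<in>I. s j * ln (s j))"
  have "real n * - (1 / S) - E \<le> ln (\<Sum>i\<in>I. a i)"
    using gibbs_inequality[OF I(1) s_pos s_sum, of a] a s_ln by (simp add: E_def n_def)
  also have "\<dots> < ln (1 / real n ^ (n - 1))"
    using sum_a I a n by (intro ln_less_cancel_iff[THEN iffD2] sum_pos) (auto simp: n_def)
  also have "\<dots> = - (real n - 1) * ln (real n)"
    using n by (simp add: ln_div ln_realpow of_nat_diff algebra_simps)
  finally have 1: "(real n - 1) * ln (real n) - E < real n * (1 / S)"
    by (simp add: algebra_simps)
  have "- E \<le> ln (real n)"
    using gibbs_inequality[OF I(1) s_pos s_sum, of "\<lambda>_. 1"] by (simp add: E_def n_def)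
  then have "(real n - 1) * - E \<le> (real n - 1) * ln (real n)"
    using n by (intro mult_left_mono) auto
  with 1 have "real n * - E < real n * (1 / S)"
    by (simp add: algebra_simps)
  then have "- E < 1 / S"
    by (rule mult_left_less_imp_less) simp
  then have "- (1 / S) < E" by simp
  then show ?thesis
    using s_pos s_sum s_ln by (intro exI[of _ s]) (auto simp: E_def)
qed

text \<open>
  Real weights are replaced by integer exponents: \<open>N\<^sub>i\<close> is the integer part of \<open>s\<^sub>i m / k\<^sub>i\<close>, so that
  \<open>k\<^sub>i N\<^sub>i / m\<close> tends to \<open>s\<^sub>i\<close> as \<open>m\<close> grows. The strict inequalities survive for large \<open>m\<close>.
\<close>

lemma exists_exponents:
  fixes s c :: "'i \<Rightarrow> real" and k :: "'i \<Rightarrow> nat"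
  assumes I: "finite I" and s: "\<And>i. i \<in> I \<Longrightarrow> s i > 0" and k: "\<And>i. i \<in> I \<Longrightarrow> k i \<ge> 1"
    and c: "\<And>i. i \<in> I \<Longrightarrow> s i * c i < (\<Sum>j\<in>I. s j * d j)"
  shows "\<exists>N :: 'i \<Rightarrow> nat. \<forall>i\<in>I.
    real (k i * N i) * c i < (\<Sum>j\<in>I. real (k j * N j) * d j)"
proof -
  define N where "N = (\<lambda>m i. nat \<lfloor>s i / real (k i) * real m\<rfloor>)"
  have lim: "(\<lambda>m. real (k i * N m i) / real m) \<longlonglongrightarrow> s i" if "i \<in> I" for i
  proof -
    have "s i / real (k i) > 0" using s[OF that] k[OF that] by simp
    then have "(\<lambda>m. real (N m i) / real m) \<longlonglongrightarrow> s i / real (k i)"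
      unfolding N_def by real_asymp
    from tendsto_mult_left[OF this, of "real (k i)"] show ?thesis
      using k[OF that] by simp
  qed
  have "\<forall>\<^sub>F m in sequentially. \<forall>i\<in>I.
      (\<Sum>j\<in>I. real (k j * N m j) / real m * d j) - real (k i * N m i) / real m * c i > 0"
  proof (intro eventually_ball_finite I ballI)
    fix i assume i: "i \<in> I"
    have "(\<lambda>m. (\<Sum>j\<in>I. real (k j * N m j) / real m * d j) - real (k i * N m i) / real m * c i)
        \<longlonglongrightarrow> (\<Sum>j\<in>I. s j * d j) - s i * c i"
      using i by (intro tendsto_intros lim)
    then show "\<forall>\<^sub>F m in sequentially.
        (\<Sum>j\<in>I. real (k j * N m j) / real m * d j) - real (k i * N m i) / real m * c i > 0"
      using c[OF i] by (intro order_tendstoD(1)) auto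
  qed
  then have "\<forall>\<^sub>F m in sequentially. \<forall>i\<in>I.
      real (k i * N m i) * c i < (\<Sum>j\<in>I. real (k j * N m j) * d j)"
    using eventually_gt_at_top[of 0]
  proof eventually_elim
    case (elim m)
    have "(\<Sum>j\<in>I. real (k j * N m j) / real m * d j) = (\<Sum>j\<in>I. real (k j * N m j) * d j) / real m"
      by (simp add: sum_divide_distrib)
    with elim show "\<forall>i\<in>I. real (k i * N m i) * c i < (\<Sum>j\<in>I. real (k j * N m j) * d j)"
      by (auto simp: divide_less_cancel diff_divide_distrib[symmetric])
  qed
  then obtain m where "\<forall>i\<in>I. real (k i * N m i) * c i < (\<Sum>j\<in>I. real (k j * N m j) * d j)"
    using eventually_happens'[OF sequentially_bot] by blast
  then show ?thesis by (rule exI[of _ "N m"])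
qed

section \<open>Simultaneous lower bounds\<close>

text \<open>
  The norms of the polynomials need not be attained, so the product bound is available only with
  \<open>\<bar>P\<^sub>i(z\<^sub>i)\<bar> > r\<close> for a prescribed \<open>r < 1\<close>. The exponents are therefore fixed first, and \<open>r\<close> is then
  taken so close to \<open>1\<close> that the strict inequalities between the products persist.
\<close>

lemma strict_lower_bounds_positive:
  fixes P :: "'i \<Rightarrow> 'a::complex_banach \<Rightarrow> complex"
  assumes I: "finite I" "I \<noteq> {}" and k: "\<And>i. i \<in> I \<Longrightarrow> k i \<ge> 1"
    and P: "\<And>i. i \<in> I \<Longrightarrow> polynomial_of_degree (k i) (P i)"
    and P_norm: "\<And>i. i \<in> I \<Longrightarrow> polynomial_norm (P i) = 1"
    and a: "\<And>i. i \<in> I \<Longrightarrow> a i > 0"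
    and sum_a: "(\<Sum>i\<in>I. a i) < 1 / real (card I) ^ (card I - 1)"
  shows "\<exists>z0\<in>cball 0 1. \<forall>i\<in>I. a i ^ k i \<le> cmod (P i z0)"
proof -
  obtain s where s: "\<And>i. i \<in> I \<Longrightarrow> s i > 0" "(\<Sum>i\<in>I. s i) = 1"
    and s_ln: "\<And>i. i \<in> I \<Longrightarrow> s i * ln (a i) < (\<Sum>j\<in>I. s j * ln (s j))"
    using exists_weights[OF I a sum_a] by blast
  have "\<exists>N :: 'i \<Rightarrow> nat. \<forall>i\<in>I.
      real (k i * N i) * ln (a i) < (\<Sum>j\<in>I. real (k j * N j) * ln (s j))"
    using I(1) s(1) k s_ln by (rule exists_exponents)
  then obtain N :: "'i \<Rightarrow> nat" where N_ln: "\<And>i. i \<in> I \<Longrightarrow>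
      real (k i * N i) * ln (a i) < (\<Sum>j\<in>I. real (k j * N j) * ln (s j))"
    by blast
  have powers: "(a i ^ k i) ^ N i < (\<Prod>j\<in>I. (s j ^ k j * 1) ^ N j)" if "i \<in> I" for i
  proof -
    have ln_pow: "ln ((x ^ l) ^ m) = real (l * m) * ln x" if "x > 0" for x :: real and l m
      using that by (simp only: power_mult[symmetric] ln_realpow)
    have pos: "(\<Prod>j\<in>I. (s j ^ k j) ^ N j) > 0"
      using s(1) by (intro prod_pos zero_less_power ballI)
    have "ln (\<Prod>j\<in>I. (s j ^ k j) ^ N j) = (\<Sum>j\<in>I. ln ((s j ^ k j) ^ N j))"
      using s(1) I(1) by (intro ln_prod) (auto dest!: s(1))
    also have "\<dots> = (\<Sum>j\<in>I. real (k j * N j) * ln (s j))"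
      using s(1) by (intro sum.cong ln_pow) auto
    finally have "ln ((a i ^ k i) ^ N i) < ln (\<Prod>j\<in>I. (s j ^ k j) ^ N j)"
      using N_ln[OF that] by (simp only: ln_pow[OF a[OF that]])
    then show ?thesis
      using a[OF that] pos by (simp only: ln_less_cancel_iff zero_less_power mult_1_right)
  qed
  \<comment> \<open>The factor \<open>1\<close> in \<open>powers\<close> is the limit of \<open>r\<close>.\<close>
  have "\<forall>\<^sub>F r in at_left 1. \<forall>i\<in>I. (a i ^ k i) ^ N i < (\<Prod>j\<in>I. (s j ^ k j * r) ^ N j)"
  proof (intro eventually_ball_finite I ballI)
    fix i assume i: "i \<in> I"
    have "((\<lambda>r. \<Prod>j\<in>I. (s j ^ k j * r) ^ N j) \<longlongrightarrow> (\<Prod>j\<in>I. (s j ^ k j * 1) ^ N j)) (at_left 1)"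
      by (intro tendsto_intros)
    with powers[OF i]
    show "\<forall>\<^sub>F r in at_left 1. (a i ^ k i) ^ N i < (\<Prod>j\<in>I. (s j ^ k j * r) ^ N j)"
      by (rule order_tendstoD(1)[rotated])
  qed
  moreover have "\<forall>\<^sub>F r in at_left (1::real). r \<in> {0<..<1}"
    by (rule eventually_at_left_real) simp
  ultimately have "\<forall>\<^sub>F r in at_left (1::real). r \<in> {0<..<1} \<and>
      (\<forall>i\<in>I. (a i ^ k i) ^ N i < (\<Prod>j\<in>I. (s j ^ k j * r) ^ N j))"
    by eventually_elim simp
  then have "\<exists>r::real. r \<in> {0<..<1} \<and>
      (\<forall>i\<in>I. (a i ^ k i) ^ N i < (\<Prod>j\<in>I. (s j ^ k j * r) ^ N j))"
    by (rule eventually_happens'[OF trivial_limit_at_left_real])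
  then obtain r :: real where "r \<in> {0<..<1}"
    and ra: "\<And>i. i \<in> I \<Longrightarrow> (a i ^ k i) ^ N i < (\<Prod>j\<in>I. (s j ^ k j * r) ^ N j)"
    by blast
  then have r: "0 < r" "r < 1" by auto
  have "\<forall>i\<in>I. \<exists>z. norm z \<le> 1 \<and> r < cmod (P i z)"
  proof
    fix i assume i: "i \<in> I"
    obtain z where "z \<in> cball 0 1" "r < cmod (P i z)"
      using polynomial_almost_attains_norm[OF P[OF i], of r] P_norm[OF i] r(2) by metis
    then show "\<exists>z. norm z \<le> 1 \<and> r < cmod (P i z)" by auto
  qed
  then obtain z where z: "\<And>i. i \<in> I \<Longrightarrow> norm (z i) \<le> 1"
    and Pz: "\<And>i. i \<in> I \<Longrightarrow> r < cmod (P i (z i))"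
    by metis
  have "\<exists>z0\<in>cball 0 1. (\<Prod>i\<in>I. (s i ^ k i * cmod (P i (z i))) ^ N i) \<le>
      (\<Prod>i\<in>I. cmod (P i z0) ^ N i)"
    using I(1) P z less_imp_le[OF s(1)] eq_refl[OF s(2)] by (rule polynomial_product_lower_bound)
  then obtain z0 where z0: "z0 \<in> cball 0 1"
    and prod_le: "(\<Prod>i\<in>I. (s i ^ k i * cmod (P i (z i))) ^ N i) \<le> (\<Prod>i\<in>I. cmod (P i z0) ^ N i)"
    by blast
  have P_le_1: "cmod (P j z0) \<le> 1" if "j \<in> I" for j
    using polynomial_le_norm[OF P[OF that] z0] P_norm[OF that] by simp
  have "a i ^ k i \<le> cmod (P i z0)" if i: "i \<in> I" for i
  proof -
    have "(a i ^ k i) ^ N i < (\<Prod>j\<in>I. (s j ^ k j * r) ^ N j)"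
      by (rule ra[OF i])
    also have "\<dots> \<le> (\<Prod>j\<in>I. (s j ^ k j * cmod (P j (z j))) ^ N j)"
      using s(1) r Pz by (intro prod_mono conjI power_mono mult_left_mono) (auto simp: less_imp_le)
    also have "\<dots> \<le> (\<Prod>j\<in>I. cmod (P j z0) ^ N j)"
      by (rule prod_le)
    also have "\<dots> = cmod (P i z0) ^ N i * (\<Prod>j\<in>I - {i}. cmod (P j z0) ^ N j)"
      using I(1) i by (rule prod.remove)
    also have "\<dots> \<le> cmod (P i z0) ^ N i * 1"
      using P_le_1 by (intro mult_left_mono prod_le_1) (auto simp: power_le_one)
    finally have "(a i ^ k i) ^ N i < cmod (P i z0) ^ N i" by simp
    then show ?thesis by (meson less_imp_le norm_ge_zero power_less_imp_less_base)
  qed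
  then show ?thesis by (intro bexI[OF _ z0] ballI)
qed

text \<open>
  Logarithms of the \<open>a\<^sub>i\<close> are needed above. Here all \<open>a\<^sub>i\<close> are increased by the same amount \<open>e\<close>,
  which uses up half of the gap in the strict inequality.
\<close>

lemma strict_lower_bounds:
  fixes P :: "'i \<Rightarrow> 'a::complex_banach \<Rightarrow> complex"
  assumes I: "finite I" "I \<noteq> {}" and k: "\<And>i. i \<in> I \<Longrightarrow> k i \<ge> 1"
    and P: "\<And>i. i \<in> I \<Longrightarrow> polynomial_of_degree (k i) (P i)"
    and P_norm: "\<And>i. i \<in> I \<Longrightarrow> polynomial_norm (P i) = 1"
    and a: "\<And>i. i \<in> I \<Longrightarrow> a i \<ge> 0"
    and sum_a: "(\<Sum>i\<in>I. a i) < 1 / real (card I) ^ (card I - 1)"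
  shows "\<exists>z0\<in>cball 0 1. \<forall>i\<in>I. a i ^ k i \<le> cmod (P i z0)"
proof -
  let ?B = "1 / real (card I) ^ (card I - 1)"
  define e where "e = (?B - (\<Sum>i\<in>I. a i)) / (2 * real (card I))"
  have card: "real (card I) > 0" using I by (simp add: card_gt_0_iff)
  then have e: "e > 0" unfolding e_def using sum_a by (intro divide_pos_pos) auto
  have "(\<Sum>i\<in>I. a i + e) = (\<Sum>i\<in>I. a i) + (?B - (\<Sum>i\<in>I. a i)) / 2"
    using card by (simp add: sum.distrib e_def)
  with sum_a have "(\<Sum>i\<in>I. a i + e) < ?B"
    by (simp add: field_simps)
  then have "\<exists>z0\<in>cball 0 1. \<forall>i\<in>I. (a i + e) ^ k i \<le> cmod (P i z0)"
    using I k P P_norm a e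
    by (intro strict_lower_bounds_positive) (auto simp: add_nonneg_pos)
  then obtain z0 where "z0 \<in> cball 0 1" "\<And>i. i \<in> I \<Longrightarrow> (a i + e) ^ k i \<le> cmod (P i z0)"
    by blast
  moreover have "a i ^ k i \<le> (a i + e) ^ k i" if "i \<in> I" for i
    using that a e by (intro power_mono) auto
  ultimately show ?thesis by (meson order_trans)
qed

section \<open>Finite dimension\<close>

text \<open>
  The dimension is not tied to a type, so the coordinates are functions on the whole space that
  vanish outside a basis \<open>B\<close>, with the topology of pointwise convergence. The sphere \<open>E\<close> of
  coordinates with maximum modulus \<open>1\<close> is compact, and its image under the coordinate map \<open>f\<close>
  misses \<open>0\<close> by linear independence, hence misses a ball of some radius \<open>r\<close>. Scaling shows that
  vectors in the unit ball have coordinates of modulus at most \<open>1 / r\<close>. The unit ball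
  is then a closed subset of the image of a compact box.
\<close>

lemma compact_unit_ball:
  assumes "finite_dimensional TYPE('a::complex_banach)"
  shows "compact (cball (0 :: 'a) 1)"
proof -
  obtain B where "finite_dimensional_vector_space (scaleC :: complex \<Rightarrow> 'a \<Rightarrow> 'a) B"
    using assms unfolding finite_dimensional_def by auto
  then interpret V: finite_dimensional_vector_space "scaleC :: complex \<Rightarrow> 'a \<Rightarrow> 'a" B .
  note B = V.finite_Basis
  define f where "f = (\<lambda>c. \<Sum>b\<in>B. scaleC (c b) b)"
  have lin: "bounded_linear (\<lambda>c. scaleC c b)" for b :: 'a
    by (rule bounded_linear_intro[of _ "norm b"])
      (simp_all add: scaleC_add_left norm_scaleC scaleR_scaleC scaleC_scaleC scaleC_complex_def)
  have cont: "continuous_on UNIV f"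
    unfolding f_def
    by (intro continuous_on_sum bounded_linear.continuous_on[OF lin] continuous_on_product_coordinates)
  have box: "compact (PiE UNIV S)" if "\<And>b. compact (S b)" for S :: "'a \<Rightarrow> complex set"
  proof -
    have "compactin (product_topology (\<lambda>_. euclidean) UNIV) (PiE UNIV S)"
      using that by (simp add: compactin_PiE)
    then show ?thesis by (simp add: euclidean_product_topology)
  qed
  define D where "D = (\<lambda>r b. if b \<in> B then cball (0 :: complex) r else {0})"
  define E where "E = (\<Union>b\<in>B. PiE UNIV ((D 1)(b := sphere 0 1)))"
  have D_compact: "compact (D r b)" for r b by (simp add: D_def)
  have "compact E"
    unfolding E_def using B D_compact by (intro compact_UN box) auto
  then have fE: "closed (f ` E)"
    by (meson compact_continuous_image compact_imp_closed cont continuous_on_subset subset_UNIV)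
  have "0 \<notin> f ` E"
  proof
    assume "0 \<in> f ` E"
    then obtain c b where b: "b \<in> B" and c: "c \<in> PiE UNIV ((D 1)(b := sphere 0 1))" "f c = 0"
      unfolding E_def by (metis (no_types, lifting) UN_E imageE)
    have "c b \<in> sphere 0 1"
      using PiE_mem[OF c(1), of b] by simp
    from b c(2) have "c b = 0"
      using V.independentD[OF V.independent_Basis B order_refl, of c] by (simp add: f_def)
    with \<open>c b \<in> sphere 0 1\<close> show False by simp
  qed
  with fE obtain r where r: "r > 0" "ball 0 r \<subseteq> - (f ` E)"
    by (metis Compl_iff open_Compl openE)
  have "x \<in> f ` PiE UNIV (D (1 / r))" if x: "x \<in> cball 0 1" for x
  proof -
    have "x \<in> range (\<lambda>c. \<Sum>b\<in>B. scaleC (c b) b)"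
      using V.span_Basis by (simp only: V.span_finite[OF B, symmetric] UNIV_I)
    then obtain c where c: "x = (\<Sum>b\<in>B. scaleC (c b) b)"
      by blast
    have "cmod (c b) \<le> 1 / r" if b: "b \<in> B" for b
    proof (rule ccontr)
      assume contra: "\<not> cmod (c b) \<le> 1 / r"
      have "Max ((\<lambda>b. cmod (c b)) ` B) \<in> (\<lambda>b. cmod (c b)) ` B"
        using b B by (intro Max_in) auto
      then obtain m where "m \<in> B" "Max ((\<lambda>b. cmod (c b)) ` B) = cmod (c m)"
        by blast
      then have m: "m \<in> B" "\<And>b. b \<in> B \<Longrightarrow> cmod (c b) \<le> cmod (c m)"
        using B by (auto simp flip: \<open>Max _ = _\<close>)
      define M where "M = cmod (c m)"
      have M: "M > 1 / r" "M > 0"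
        using contra m(2)[OF b] r(1) unfolding M_def
        by (auto intro: less_le_trans[of 0 "1 / r"])
      \<comment> \<open>Normalized to maximum modulus \<open>1\<close>, the coordinates of \<open>x\<close> yield a point of \<open>f ` E\<close> of norm
        less than \<open>r\<close>.\<close>
      define c' where "c' = (\<lambda>b. if b \<in> B then c b / complex_of_real M else 0)"
      have "c' \<in> PiE UNIV ((D 1)(m := sphere 0 1))"
        using m M(2) by (auto simp: c'_def D_def PiE_iff norm_divide M_def[symmetric])
      then have "f c' \<in> f ` E" unfolding E_def using m(1) by blast
      moreover have "f c' = scaleC (1 / complex_of_real M) x"
        unfolding c f_def by (simp add: V.scale_sum_right scaleC_scaleC c'_def)
      then have "norm (f c') < r"
        using x M r(1) mult_left_mono[of "norm x" 1 "1 / M"]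
        by (simp add: norm_scaleC norm_divide field_simps)
      ultimately show False using r(2) by (auto simp: subset_iff)
    qed
    then have "(\<lambda>b. if b \<in> B then c b else 0) \<in> PiE UNIV (D (1 / r))"
      by (auto simp: D_def PiE_iff)
    moreover have "f (\<lambda>b. if b \<in> B then c b else 0) = x"
      unfolding c f_def by (intro sum.cong) auto
    ultimately show ?thesis by (metis image_eqI)
  qed
  moreover have "compact (f ` PiE UNIV (D (1 / r)))"
    using D_compact by (intro compact_continuous_image box continuous_on_subset[OF cont]) auto
  ultimately show ?thesis
    by (metis (no_types, lifting) closed_cball compact_Int_closed inf.absorb_iff2 subsetI)
qed

section \<open>The plank theorem for polynomials\<close>

text \<open>
  If the sum of the \<open>a\<^sub>i\<close> equals \<open>1 / n ^ (n - 1)\<close>, the strict case applies to \<open>r\<^sub>m a\<^sub>i\<close> with \<open>r\<^sub>m < 1\<close>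
  tending to \<open>1\<close>, and a limit point of the vectors so obtained has the required property.
\<close>

theorem theorem1p5:
  fixes P :: "nat \<Rightarrow> 'a::complex_banach \<Rightarrow> complex"
    and k :: "nat \<Rightarrow> nat" and a :: "nat \<Rightarrow> real" and n :: nat
  assumes "n \<ge> 1"
    and "\<And>i. i \<in> {1..n} \<Longrightarrow> k i \<ge> 1"
    and "\<And>i. i \<in> {1..n} \<Longrightarrow> polynomial_of_degree (k i) (P i)"
    and "\<And>i. i \<in> {1..n} \<Longrightarrow> polynomial_norm (P i) = 1"
    and "\<And>i. i \<in> {1..n} \<Longrightarrow> a i \<ge> 0"
  shows "((\<Sum>i=1..n. a i) < 1 / real n ^ (n - 1) \<longrightarrow>
            (\<exists>z0 \<in> cball 0 1. \<forall>i\<in>{1..n}. cmod (P i z0) \<ge> a i ^ k i)) \<and>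
         (finite_dimensional TYPE('a) \<and> (\<Sum>i=1..n. a i) = 1 / real n ^ (n - 1) \<longrightarrow>
            (\<exists>z0 \<in> cball 0 1. \<forall>i\<in>{1..n}. cmod (P i z0) \<ge> a i ^ k i))"
proof (intro conjI impI)
  have strict: "\<exists>z0 \<in> cball 0 1. \<forall>i\<in>{1..n}. cmod (P i z0) \<ge> c i ^ k i"
    if "\<And>i. i \<in> {1..n} \<Longrightarrow> c i \<ge> 0" "(\<Sum>i=1..n. c i) < 1 / real n ^ (n - 1)" for c
    using strict_lower_bounds[of "{1..n}" k P c] assms that by simp
  show "\<exists>z0 \<in> cball 0 1. \<forall>i\<in>{1..n}. cmod (P i z0) \<ge> a i ^ k i"
    if "(\<Sum>i=1..n. a i) < 1 / real n ^ (n - 1)"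
    using strict[OF assms(5) that] .
  show "\<exists>z0 \<in> cball 0 1. \<forall>i\<in>{1..n}. cmod (P i z0) \<ge> a i ^ k i"
    if fin: "finite_dimensional TYPE('a) \<and> (\<Sum>i=1..n. a i) = 1 / real n ^ (n - 1)"
  proof -
    define r where "r = (\<lambda>m. 1 - 1 / real (m + 2))"
    have r: "0 \<le> r m" "r m < 1" for m by (auto simp: r_def)
    have r_lim: "r \<longlonglongrightarrow> 1" unfolding r_def by real_asymp
    have "\<exists>z0 \<in> cball 0 1. \<forall>i\<in>{1..n}. cmod (P i z0) \<ge> (r m * a i) ^ k i" for m
    proof (rule strict)
      have "(\<Sum>i=1..n. r m * a i) = r m * (1 / real n ^ (n - 1))"
        using fin by (simp add: sum_distrib_left[symmetric])
      also have "\<dots> < 1 * (1 / real n ^ (n - 1))"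
        using r assms(1) by (intro mult_strict_right_mono) auto
      finally show "(\<Sum>i=1..n. r m * a i) < 1 / real n ^ (n - 1)" by simp
    qed (use r assms(5) in simp)
    then obtain z where z: "\<And>m. z m \<in> cball 0 1"
      and Pz: "\<And>m i. i \<in> {1..n} \<Longrightarrow> (r m * a i) ^ k i \<le> cmod (P i (z m))"
      by metis
    obtain l \<sigma> where l: "l \<in> cball 0 1" and \<sigma>: "strict_mono \<sigma>" "(z \<circ> \<sigma>) \<longlonglongrightarrow> l"
      using compact_unit_ball[where 'a = 'a] fin z unfolding compact_def by metis
    have "a i ^ k i \<le> cmod (P i l)" if i: "i \<in> {1..n}" for i
    proof (rule LIMSEQ_le)
      have "(\<lambda>m. r (\<sigma> m)) \<longlonglongrightarrow> 1"
        using LIMSEQ_subseq_LIMSEQ[OF r_lim \<sigma>(1)] by (simp add: o_def)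
      then have "(\<lambda>m. (r (\<sigma> m) * a i) ^ k i) \<longlonglongrightarrow> (1 * a i) ^ k i"
        by (intro tendsto_intros)
      then show "(\<lambda>m. (r (\<sigma> m) * a i) ^ k i) \<longlonglongrightarrow> a i ^ k i" by simp
      have "(\<lambda>m. P i (z (\<sigma> m))) \<longlonglongrightarrow> P i l"
        using continuous_on_tendsto_compose[OF polynomial_continuous[OF assms(3)[OF i], of UNIV] \<sigma>(2)]
        by (simp add: o_def)
      then show "(\<lambda>m. cmod (P i (z (\<sigma> m)))) \<longlonglongrightarrow> cmod (P i l)"
        by (rule tendsto_norm)
    qed (use Pz i in auto)
    with l show ?thesis by blast
  qed
qed

end
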